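(* Let $n \geqslant 0$. Then the number of maximally extendable transfer systems in $L(n)$ is given by $\mathfrak{S}_{n+1}$, and the number of maximally extendable transfer systems in $L(n)$ with exactly $k$ stationary elements is $\mathfrak{S}_{n+1}(k)$ (for $1\leqslant k\leqslant n+1$).
   Context: $[n]=\{0<1<\cdots<n\}$ and $[1]\times[n]$ has the product order. A transfer system on a lattice is a partial order $\mathcal{R}$ on its underlying set such that $x\,\mathcal{R}\,y$ implies $x\leqslant y$, and whenever $x\,\mathcal{R}\,y$ and $z\leqslant y$ we have $(x\wedge z)\,\mathcal{R}\,z$. A transfer system $\mathcal{R}$ on $[1]\times[n]$ is liftable if whenever $(1,i)\,\mathcal{R}\,(1,j)$ for some $i<j$, then $(0,i)\,\mathcal{R}\,(1,i)$. $L(n)$ is the set of liftable transfer systems on $[1]\times[n]$. For a transfer system $\mathcal{R}$ on $[1]\times[n]$: an element $(1,b)$ is stationary if there are no $c,d$ with $d>b\geqslant c$ and $(1,c)\,\mathcal{R}\,(1,d)$; an element $(0,b)$ is extendable if $(0,b)\,\mathcal{R}\,(0,n)$ (elements $(0,b)$ are never stationary and elements $(1,b)$ are never extendable). $\mathcal{R}$ is maximally extendable if it has $n+1$ extendable elements. A royal $n$-path is a lattice path from $(0,0)$ to $(n,n)$ using single steps north $(0,1)$, northeast $(1,1)$, or east $(1,0)$ that does not rise above the diagonal from $(0,0)$ to $(n,n)$. The $n$-th (large) Schröder number $\mathfrak{S}_n$ is the number of royal $n$-paths. The refined Schröder number $\mathfrak{S}_n(k)$ is the number of royal $n$-paths with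 exactly $k$ returns to the diagonal, where the returns are the points of the path after the starting point that lie on the diagonal (so a northeast step along the diagonal counts as a return). *)

theory Defs
  imports "HOL-Library.Product_Order" "HOL-Library.Product_Plus"
begin

definition transfer_system :: "'a::lattice set \<Rightarrow> 'a rel \<Rightarrow> bool" where
  (* The lattice is a carrier set A closed under the ambient inf and sup. *)
  "transfer_system A R \<longleftrightarrow>
     partial_order_on A R \<and>
     (\<forall>x y. (x, y) \<in> R \<longrightarrow> x \<le> y) \<and>
     (\<forall>x y z. (x, y) \<in> R \<and> z \<in> A \<and> z \<le> y \<longrightarrow> (inf x z, z) \<in> R)"

definition grid :: "nat \<Rightarrow> (nat \<times> nat) set" where
  (* Product_Order makes the order and the meet on pairs componentwise. *)
  "grid n = {..1} \<times> {..n}"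

lemma grid_sublattice:
  assumes "x \<in> grid n" "y \<in> grid n"
  shows "inf x y \<in> grid n" and "sup x y \<in> grid n"
  using assms by (auto simp: grid_def inf_prod_def sup_prod_def inf_nat_def sup_nat_def)

definition liftable :: "nat \<Rightarrow> (nat \<times> nat) rel \<Rightarrow> bool" where
  "liftable n R \<longleftrightarrow>
     (\<forall>i j. i < j \<and> j \<le> n \<and> ((1, i), (1, j)) \<in> R \<longrightarrow> ((0, i), (1, i)) \<in> R)"

definition liftable_transfer_systems :: "nat \<Rightarrow> (nat \<times> nat) rel set" where
  "liftable_transfer_systems n = {R. transfer_system (grid n) R \<and> liftable n R}"

definition stationary_elements :: "nat \<Rightarrow> (nat \<times> nat) rel \<Rightarrow> (nat \<times> nat) set" where
  "stationary_elements n R =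
     {(1, b) | b. b \<le> n \<and> \<not> (\<exists>c d. d \<le> n \<and> d > b \<and> b \<ge> c \<and> ((1, c), (1, d)) \<in> R)}"

definition extendable_elements :: "nat \<Rightarrow> (nat \<times> nat) rel \<Rightarrow> (nat \<times> nat) set" where
  "extendable_elements n R = {(0, b) | b. b \<le> n \<and> ((0, b), (0, n)) \<in> R}"

definition maximally_extendable :: "nat \<Rightarrow> (nat \<times> nat) rel \<Rightarrow> bool" where
  "maximally_extendable n R \<longleftrightarrow> card (extendable_elements n R) = n + 1"

(* A path starting at (0,0) is encoded by its list of steps;
   path_point w i is the lattice point reached after the first i steps. *)

definition path_point :: "(nat \<times> nat) list \<Rightarrow> nat \<Rightarrow> nat \<times> nat" where
  "path_point w i = sum_list (take i w)"

definition royal_paths :: "nat \<Rightarrow> (nat \<times> nat) list set" where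
  (* Steps are straight segments, so the path stays weakly below the diagonal
     iff the endpoints of its steps do. *)
  "royal_paths n =
     {w. set w \<subseteq> {(0, 1), (1, 1), (1, 0)} \<and>
         path_point w (length w) = (n, n) \<and>
         (\<forall>i \<le> length w. snd (path_point w i) \<le> fst (path_point w i))}"

definition path_returns :: "(nat \<times> nat) list \<Rightarrow> (nat \<times> nat) set" where
  "path_returns w =
     {path_point w i | i. 0 < i \<and> i \<le> length w \<and> fst (path_point w i) = snd (path_point w i)}"

definition schroeder :: "nat \<Rightarrow> nat" where
  "schroeder n = card (royal_paths n)"

definition refined_schroeder :: "nat \<Rightarrow> nat \<Rightarrow> nat" where
  "refined_schroeder n k = card {w \<in> royal_paths n. card (path_returns w) = k}"

end

theory Submission
  imports Defs
begin

text \<open>Maximal extendability makes the bottom row of a transfer system the full order, so only the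
  vertical-diagonal part D and the strict top row T remain. Let h(N, s) count such pairs (D, T) on N
  columns with s stationary elements. If \<open>(0, 0)\<close> is not related to the last top element, then that
  element is isolated and can be dropped, together with one stationary element. Otherwise the first
  column can be removed: it is determined by the last top element t related to \<open>(1, 0)\<close>, and t
  ranges over 0 and the stationary elements of the remainder. A remainder with j stationary elements
  thus yields each of \<open>1, \<dots>, j + 1\<close> stationary elements exactly once, whence
  \<open>h(N + 1, s + 1) = h(N, s) + (\<Sum>j\<ge>s. h(N, j))\<close>.
  Royal paths obey the same recursion: either the first step is northeast, or it is east, and then
  deleting it and the first step north back to the diagonal merges the first primitive block with the
  rest, while the number of later returns tells where the deleted north step was.\<close>

section \<open>Reduced transfer systems\<close>

text \<open>The columns are \<open>0, ..., N - 1\<close>, so that \<open>N = 0\<close> is available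
  as the base case of the recursion. \<open>(i, j) \<in> D\<close> stands for an arrow from
  \<open>(0, i)\<close> to \<open>(1, j)\<close>, and T holds the non-reflexive arrows of the top
  row. After the bounds, the clauses are transitivity along the full bottom row, restriction of D,
  the two remaining forms of transitivity, restriction of T, and liftability.\<close>

definition reduced :: "nat \<Rightarrow> (nat rel \<times> nat rel) set" where
  "reduced N = {(D, T).
     (\<forall>i j. (i, j) \<in> D \<longrightarrow> i \<le> j \<and> j < N) \<and>
     (\<forall>i j. (i, j) \<in> T \<longrightarrow> i < j \<and> j < N) \<and>
     (\<forall>i j k. (i, j) \<in> D \<longrightarrow> k \<le> i \<longrightarrow> (k, j) \<in> D) \<and>
     (\<forall>i j k. (i, j) \<in> D \<longrightarrow> i \<le> k \<longrightarrow> k \<le> j \<longrightarrow> (i, k) \<in> D) \<and>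
     (\<forall>i j k. (i, j) \<in> D \<longrightarrow> (j, k) \<in> T \<longrightarrow> (i, k) \<in> D) \<and>
     (\<forall>i j k. (i, j) \<in> T \<longrightarrow> (j, k) \<in> T \<longrightarrow> (i, k) \<in> T) \<and>
     (\<forall>i j k. (i, j) \<in> T \<longrightarrow> i < k \<longrightarrow> k \<le> j \<longrightarrow> (i, k) \<in> T) \<and>
     (\<forall>i j. (i, j) \<in> T \<longrightarrow> (i, i) \<in> D)}"

lemma reducedD:
  assumes "(D, T) \<in> reduced N"
  shows "(i, j) \<in> D \<Longrightarrow> i \<le> j" "(i, j) \<in> D \<Longrightarrow> j < N"
    and "(i, j) \<in> T \<Longrightarrow> i < j" "(i, j) \<in> T \<Longrightarrow> j < N"
    and "(i, j) \<in> D \<Longrightarrow> k \<le> i \<Longrightarrow> (k, j) \<in> D"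
    and "(i, j) \<in> D \<Longrightarrow> i \<le> k \<Longrightarrow> k \<le> j \<Longrightarrow> (i, k) \<in> D"
    and "(i, j) \<in> D \<Longrightarrow> (j, k) \<in> T \<Longrightarrow> (i, k) \<in> D"
    and "(i, j) \<in> T \<Longrightarrow> (j, k) \<in> T \<Longrightarrow> (i, k) \<in> T"
    and "(i, j) \<in> T \<Longrightarrow> i < k \<Longrightarrow> k \<le> j \<Longrightarrow> (i, k) \<in> T"
    and "(i, j) \<in> T \<Longrightarrow> (i, i) \<in> D"
  using assms unfolding reduced_def mem_Collect_eq prod.case by metis+

lemma reducedI:
  assumes "\<And>i j. (i, j) \<in> D \<Longrightarrow> i \<le> j \<and> j < N"
    and "\<And>i j. (i, j) \<in> T \<Longrightarrow> i < j \<and> j < N"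
    and "\<And>i j k. (i, j) \<in> D \<Longrightarrow> k \<le> i \<Longrightarrow> (k, j) \<in> D"
    and "\<And>i j k. (i, j) \<in> D \<Longrightarrow> i \<le> k \<Longrightarrow> k \<le> j \<Longrightarrow> (i, k) \<in> D"
    and "\<And>i j k. (i, j) \<in> D \<Longrightarrow> (j, k) \<in> T \<Longrightarrow> (i, k) \<in> D"
    and "\<And>i j k. (i, j) \<in> T \<Longrightarrow> (j, k) \<in> T \<Longrightarrow> (i, k) \<in> T"
    and "\<And>i j k. (i, j) \<in> T \<Longrightarrow> i < k \<Longrightarrow> k \<le> j \<Longrightarrow> (i, k) \<in> T"
    and "\<And>i j. (i, j) \<in> T \<Longrightarrow> (i, i) \<in> D"
  shows "(D, T) \<in> reduced N"
  unfolding reduced_def mem_Collect_eq prod.case by ((rule conjI)?, intro allI impI, rule assms, assumption+)+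

lemma reduced_change_bound:
  assumes "(D, T) \<in> reduced M" "\<And>i j. (i, j) \<in> D \<Longrightarrow> j < N" "\<And>i j. (i, j) \<in> T \<Longrightarrow> j < N"
  shows "(D, T) \<in> reduced N"
proof -
  note r = reducedD[OF assms(1)]
  show ?thesis
    by (rule reducedI; (rule conjI)?; (rule r(1,3,5-10) assms(2,3), assumption+))
qed

text \<open>These are the columns of the stationary elements.\<close>

definition uncrossed :: "nat \<Rightarrow> nat rel \<Rightarrow> nat set" where
  "uncrossed N T = {b. b < N \<and> (\<forall>c d. (c, d) \<in> T \<longrightarrow> c \<le> b \<longrightarrow> d \<le> b)}"

lemma finite_uncrossed [simp]: "finite (uncrossed N T)"
  by (rule finite_subset[of _ "{..<N}"]) (auto simp: uncrossed_def)

lemma finite_reduced: "finite (reduced N)"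
proof (rule finite_subset)
  show "reduced N \<subseteq> Pow ({..<N} \<times> {..<N}) \<times> Pow ({..<N} \<times> {..<N})"
  proof
    fix X assume X: "X \<in> reduced N"
    note r = reducedD(1-4)[of "fst X" "snd X" N, simplified, OF X]
    have "i < N \<and> j < N" if "(i, j) \<in> fst X" for i j
      using r(1,2)[OF that] by simp
    moreover have "i < N \<and> j < N" if "(i, j) \<in> snd X" for i j
      using r(3,4)[OF that] by simp
    ultimately have "fst X \<subseteq> {..<N} \<times> {..<N}" "snd X \<subseteq> {..<N} \<times> {..<N}"
      by auto
    then show "X \<in> Pow ({..<N} \<times> {..<N}) \<times> Pow ({..<N} \<times> {..<N})"
      by (simp add: mem_Times_iff)
  qed
qed simp

lemma reduced_0: "reduced 0 = {({}, {})}"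
  by (auto simp: reduced_def)

section \<open>Correspondence between transfer systems and reduced pairs\<close>

definition reduce :: "(nat \<times> nat) rel \<Rightarrow> nat rel \<times> nat rel" where
  "reduce R = ({(i, j). ((0, i), (1, j)) \<in> R}, {(i, j). i < j \<and> ((1, i), (1, j)) \<in> R})"

text \<open>Intended inverse of \<open>reduce\<close>: the complete bottom row and the reflexive
  pairs of the top row are put back.\<close>

definition expand :: "nat \<Rightarrow> nat rel \<times> nat rel \<Rightarrow> (nat \<times> nat) rel" where
  "expand n X = {((a, i), (b, j)). i \<le> n \<and> j \<le> n \<and>
     (a = 0 \<and> b = 0 \<and> i \<le> j \<or> a = 0 \<and> b = 1 \<and> (i, j) \<in> fst X \<or>
      a = 1 \<and> b = 1 \<and> (i = j \<or> (i, j) \<in> snd X))}"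

lemma transfer_system_gridD:
  assumes "transfer_system (grid n) R"
  shows "((a, i), (b, j)) \<in> R \<Longrightarrow> a \<le> b \<and> i \<le> j \<and> b \<le> 1 \<and> j \<le> n"
    and "a \<le> 1 \<Longrightarrow> i \<le> n \<Longrightarrow> ((a, i), (a, i)) \<in> R"
    and "(x, y) \<in> R \<Longrightarrow> (y, z) \<in> R \<Longrightarrow> (x, z) \<in> R"
    and "((a, i), (b, j)) \<in> R \<Longrightarrow> c \<le> b \<Longrightarrow> k \<le> j \<Longrightarrow> ((min a c, min i k), (c, k)) \<in> R"
proof -
  have R: "R \<subseteq> grid n \<times> grid n" "refl_on (grid n) R" "trans R"
    using assms by (auto simp: transfer_system_def partial_order_on_def preorder_on_def)
  have le: "x \<le> y" if "(x, y) \<in> R" for x y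
    using that assms unfolding transfer_system_def by blast
  show 1: "((a, i), (b, j)) \<in> R \<Longrightarrow> a \<le> b \<and> i \<le> j \<and> b \<le> 1 \<and> j \<le> n" for a b i j
    using R(1) le[of "(a, i)" "(b, j)"] by (auto simp: grid_def)
  show "a \<le> 1 \<Longrightarrow> i \<le> n \<Longrightarrow> ((a, i), (a, i)) \<in> R"
    using R(2) by (auto simp: grid_def refl_on_def)
  show "(x, y) \<in> R \<Longrightarrow> (y, z) \<in> R \<Longrightarrow> (x, z) \<in> R"
    using R(3) by (meson transD)
  show "((a, i), (b, j)) \<in> R \<Longrightarrow> c \<le> b \<Longrightarrow> k \<le> j \<Longrightarrow> ((min a c, min i k), (c, k)) \<in> R"
    using assms 1[of a i b j]
    unfolding transfer_system_def
    by (auto simp: grid_def inf_nat_def dest!: spec[of _ "(a, i)"] spec[of _ "(b, j)"] spec[of _ "(c, k)"])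
qed

text \<open>There are only \<open>n + 1\<close> elements in the bottom row, so the cardinality is
  attained only if all of them are extendable.\<close>

lemma maximally_extendable_iff:
  "maximally_extendable n R \<longleftrightarrow> (\<forall>b \<le> n. ((0, b), (0, n)) \<in> R)"
proof -
  have eq: "extendable_elements n R = Pair 0 ` {b \<in> {..n}. ((0, b), (0, n)) \<in> R}"
    by (auto simp: extendable_elements_def)
  have "card (extendable_elements n R) = card {b \<in> {..n}. ((0, b), (0, n)) \<in> R}"
    unfolding eq by (rule card_image) (auto simp: inj_on_def)
  moreover have "card {b \<in> {..n}. ((0, b), (0, n)) \<in> R} = n + 1 \<longleftrightarrow>
      {b \<in> {..n}. ((0, b), (0, n)) \<in> R} = {..n}"
    using card_subset_eq[of "{..n}" "{b \<in> {..n}. ((0, b), (0, n)) \<in> R}"] by auto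
  ultimately show ?thesis
    unfolding maximally_extendable_def by auto
qed

text \<open>Once the bottom row is known to be complete, closure of D under smaller sources is
  composition with a bottom arrow; the other clauses are direct instances of transitivity,
  restriction and liftability.\<close>

lemma reduce_in_reduced:
  assumes R: "transfer_system (grid n) R" and "liftable n R" and "maximally_extendable n R"
  shows "reduce R \<in> reduced (Suc n)" and "expand n (reduce R) = R"
proof -
  note D = transfer_system_gridD[OF R]
  \<comment> \<open>The arrow from \<open>(0, i)\<close> to \<open>(0, n)\<close>, restricted to
    \<open>(0, j)\<close>, has source \<open>(0, i)\<close> because
    \<open>i \<le> j\<close>.\<close>
  have bottom: "((0, i), (0, j)) \<in> R \<longleftrightarrow> i \<le> j \<and> j \<le> n" for i j
  proof
    assume "i \<le> j \<and> j \<le> n"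
    then show "((0, i), (0, j)) \<in> R"
      using assms(3) D(4)[of 0 i 0 n 0 j] by (simp add: maximally_extendable_iff min_def)
  qed (use D(1) in blast)
  have lift: "((0, i), (1, i)) \<in> R" if "((1, i), (1, j)) \<in> R" "i < j" for i j
    using assms(2) that D(1)[OF that(1)] by (auto simp: liftable_def)
  have a1: "i \<le> j \<and> j < Suc n" if "((0, i), (1, j)) \<in> R" for i j
    using D(1)[OF that] by auto
  have a2: "j < Suc n" if "((1, i), (1, j)) \<in> R" for i j
    using D(1)[OF that] by auto
  have a3: "((0, k), (1, j)) \<in> R" if "((0, i), (1, j)) \<in> R" "k \<le> i" for i j k
    using D(3)[of "(0, k)" "(0, i)" "(1, j)"] bottom[of k i] a1[OF that(1)] that by auto
  have a4: "((0, i), (1, k)) \<in> R" if "((0, i), (1, j)) \<in> R" "i \<le> k" "k \<le> j" for i j k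
    using D(4)[of 0 i 1 j 1 k] that by (simp add: min_def)
  have a5: "((1, i), (1, k)) \<in> R" if "((1, i), (1, j)) \<in> R" "i < k" "k \<le> j" for i j k
    using D(4)[of 1 i 1 j 1 k] that by (simp add: min_def)
  show "reduce R \<in> reduced (Suc n)"
    unfolding reduce_def
  proof (rule reducedI, unfold mem_Collect_eq prod.case)
    fix i j k
    show "((0, i), (1, j)) \<in> R \<Longrightarrow> i \<le> j \<and> j < Suc n" by (rule a1)
    show "i < j \<and> ((1, i), (1, j)) \<in> R \<Longrightarrow> i < j \<and> j < Suc n" using a2 by blast
    show "((0, i), (1, j)) \<in> R \<Longrightarrow> k \<le> i \<Longrightarrow> ((0, k), (1, j)) \<in> R" by (rule a3)
    show "((0, i), (1, j)) \<in> R \<Longrightarrow> i \<le> k \<Longrightarrow> k \<le> j \<Longrightarrow> ((0, i), (1, k)) \<in> R" by (rule a4)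
    show "((0, i), (1, j)) \<in> R \<Longrightarrow> j < k \<and> ((1, j), (1, k)) \<in> R \<Longrightarrow> ((0, i), (1, k)) \<in> R"
      using D(3) by blast
    show "i < j \<and> ((1, i), (1, j)) \<in> R \<Longrightarrow> j < k \<and> ((1, j), (1, k)) \<in> R \<Longrightarrow>
        i < k \<and> ((1, i), (1, k)) \<in> R"
      using D(3) less_trans by blast
    show "i < j \<and> ((1, i), (1, j)) \<in> R \<Longrightarrow> i < k \<Longrightarrow> k \<le> j \<Longrightarrow> i < k \<and> ((1, i), (1, k)) \<in> R"
      using a5 by blast
    show "i < j \<and> ((1, i), (1, j)) \<in> R \<Longrightarrow> ((0, i), (1, i)) \<in> R"
      using lift by blast
  qed
  have "(x, y) \<in> expand n (reduce R) \<longleftrightarrow> (x, y) \<in> R" for x y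
  proof -
    obtain a i b j where xy: "x = (a, i)" "y = (b, j)"
      by (metis surj_pair)
    have *: "(a = 0 \<and> b = 0) \<or> (a = 0 \<and> b = 1) \<or> (a = 1 \<and> b = 1)"
      if "((a, i), (b, j)) \<in> R"
      using D(1)[OF that] by auto
    have "i \<le> n \<and> j \<le> n" if "((a, i), (b, j)) \<in> R"
      using D(1)[OF that] by auto
    moreover have "((1, i), (1, j)) \<in> R \<longleftrightarrow> i \<le> n \<and> j \<le> n \<and> (i = j \<or> i < j \<and> ((1, i), (1, j)) \<in> R)"
      using D(1)[of 1 i 1 j] D(2)[of 1 i] by auto
    ultimately show ?thesis
      using * bottom[of i j] unfolding xy expand_def reduce_def by auto
  qed
  then show "expand n (reduce R) = R"
    by auto
qed

lemma expand_liftable: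
  assumes "X \<in> reduced (Suc n)"
  shows "transfer_system (grid n) (expand n X)" and "liftable n (expand n X)"
    and "maximally_extendable n (expand n X)" and "reduce (expand n X) = X"
proof -
  obtain D T where X: "X = (D, T)" by fastforce
  note r = reducedD[OF assms[unfolded X]]
  have le: "(a, i) \<le> (b, j)" if "((a, i), (b, j)) \<in> expand n X" for a i b j
    using that r(1) r(3) by (fastforce simp: expand_def X)
  have "refl_on (grid n) (expand n X)"
    by (auto simp: refl_on_def expand_def grid_def)
  moreover have "expand n X \<subseteq> grid n \<times> grid n"
    by (auto simp: expand_def grid_def)
  moreover have "antisym (expand n X)"
  proof (intro antisymI)
    fix x y assume "(x, y) \<in> expand n X" "(y, x) \<in> expand n X"
    then have "x \<le> y" "y \<le> x"
      using le by (cases x; cases y; blast)+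
    then show "x = y" by (rule antisym)
  qed
  moreover have "trans (expand n X)"
  proof (intro transI)
    fix x y z assume xy: "(x, y) \<in> expand n X" and yz: "(y, z) \<in> expand n X"
    obtain a i b j c k where xyz: "x = (a, i)" "y = (b, j)" "z = (c, k)"
      by (metis surj_pair)
    have "i \<le> n" "k \<le> n"
      and A: "a = 0 \<and> b = 0 \<and> i \<le> j \<or> a = 0 \<and> b = 1 \<and> (i, j) \<in> D \<or>
        a = 1 \<and> b = 1 \<and> (i = j \<or> (i, j) \<in> T)"
      and B: "b = 0 \<and> c = 0 \<and> j \<le> k \<or> b = 0 \<and> c = 1 \<and> (j, k) \<in> D \<or>
        b = 1 \<and> c = 1 \<and> (j = k \<or> (j, k) \<in> T)"
      using xy yz by (auto simp: xyz expand_def X)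
    have "a = 0 \<and> c = 0 \<and> i \<le> k \<or> a = 0 \<and> c = 1 \<and> (i, k) \<in> D \<or>
        a = 1 \<and> c = 1 \<and> (i = k \<or> (i, k) \<in> T)"
      using A B by (elim disjE conjE; simp; metis r(5,7,8) le_trans)
    with \<open>i \<le> n\<close> \<open>k \<le> n\<close> show "(x, z) \<in> expand n X"
      by (auto simp: xyz expand_def X)
  qed
  ultimately have "partial_order_on (grid n) (expand n X)"
    by (auto simp: partial_order_on_def preorder_on_def)
  moreover have "(inf x z, z) \<in> expand n X"
    if "(x, y) \<in> expand n X" "z \<in> grid n" "z \<le> y" for x y z
  proof -
    obtain a i b j c k where xyz: "x = (a, i)" "y = (b, j)" "z = (c, k)"
      by (metis surj_pair)
    have c: "c \<le> b" "k \<le> j" "c = 0 \<or> c = 1" "k \<le> n"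
      using that xyz by (auto simp: grid_def)
    have ij: "i \<le> n" "j \<le> n" and
      "(a = 0 \<and> b = 0 \<and> i \<le> j) \<or> (a = 0 \<and> b = 1 \<and> (i, j) \<in> D) \<or>
       (a = 1 \<and> b = 1 \<and> (i = j \<or> (i, j) \<in> T))"
      using that(1) by (auto simp: xyz expand_def X)
    then consider "a = 0" "b = 0" "i \<le> j" | "a = 0" "b = 1" "(i, j) \<in> D"
      | "a = 1" "b = 1" "i = j" | "a = 1" "b = 1" "(i, j) \<in> T"
      by blast
    then have "((min a c, min i k), (c, k)) \<in> expand n X"
    proof cases
      case 1
      then show ?thesis using c ij by (auto simp: expand_def)
    next
      case 2
      \<comment> \<open>If \<open>k < i\<close>, the source is first lowered to \<open>k\<close>,
        then the target.\<close>
      have "(min i k, k) \<in> D"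
        using r(6)[of "min i k" j k] r(5)[OF 2(3), of "min i k"] c by auto
      then show ?thesis using 2 c ij by (auto simp: expand_def X)
    next
      case 3
      then show ?thesis using c ij by (auto simp: expand_def)
    next
      case 4
      \<comment> \<open>If \<open>k \<le> i\<close>, the meet is the restricted target itself and a
        reflexive pair suffices.\<close>
      have "min i k = k \<or> (min i k, k) \<in> T"
        using r(9)[OF 4(3), of k] c by (cases "i < k") auto
      then show ?thesis using 4 c ij by (auto simp: expand_def X)
    qed
    then show ?thesis
      by (simp add: xyz inf_prod_def inf_nat_def)
  qed
  ultimately show "transfer_system (grid n) (expand n X)"
    unfolding transfer_system_def using le by auto
  show "liftable n (expand n X)"
    using r(10) by (auto simp: liftable_def expand_def X)
  show "maximally_extendable n (expand n X)"
    by (simp add: maximally_extendable_iff expand_def)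
  show "reduce (expand n X) = X"
    using r(1-4) by (fastforce simp: reduce_def expand_def X)
qed

lemma bij_betw_reduce:
  "bij_betw reduce {R \<in> liftable_transfer_systems n. maximally_extendable n R} (reduced (Suc n))"
  by (rule bij_betw_byWitness[where f' = "expand n"])
    (auto simp: liftable_transfer_systems_def reduce_in_reduced expand_liftable)

lemma card_stationary:
  assumes "transfer_system (grid n) R"
  shows "card (stationary_elements n R) = card (uncrossed (Suc n) (snd (reduce R)))"
proof -
  note D = transfer_system_gridD[OF assms]
  have le: "d \<le> n" if "((1, c), (1, d)) \<in> R" for c d
    using D(1)[OF that] by simp
  have "\<not> (\<exists>c d. d \<le> n \<and> d > b \<and> b \<ge> c \<and> ((1, c), (1, d)) \<in> R) \<longleftrightarrow>
      (\<forall>c d. (c, d) \<in> snd (reduce R) \<longrightarrow> c \<le> b \<longrightarrow> d \<le> b)" for b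
    unfolding reduce_def snd_conv mem_Collect_eq prod.case
    by (metis le le_less_trans not_less)
  then have "stationary_elements n R = Pair 1 ` uncrossed (Suc n) (snd (reduce R))"
    unfolding stationary_elements_def uncrossed_def less_Suc_eq_le by blast
  then show ?thesis
    by (simp add: card_image inj_on_def)
qed

section \<open>A recursion for reduced transfer systems\<close>

text \<open>Without \<open>(0, N)\<close>, closure under smaller sources excludes every
  \<open>(i, N)\<close> from D. An arrow \<open>(i, N)\<close> of T would give
  \<open>(i, i) \<in> D\<close> by liftability and then \<open>(i, N) \<in> D\<close> by
  transitivity. Hence no arrow reaches column \<open>N\<close>.\<close>

lemma reduced_Suc_not_top:
  "{X \<in> reduced (Suc N). (0, N) \<notin> fst X} = reduced N"
proof (intro equalityI subsetI)
  fix X assume "X \<in> {X \<in> reduced (Suc N). (0, N) \<notin> fst X}"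
  moreover obtain D T where X: "X = (D, T)" by fastforce
  ultimately have DT: "(D, T) \<in> reduced (Suc N)" and top: "(0, N) \<notin> D" by auto
  note r = reducedD[OF DT]
  have 1: "(i, N) \<notin> D" for i
    using top r(5) by blast
  have 2: "(i, N) \<notin> T" for i
    using 1 r(7,10) by blast
  have "j < N" if "(i, j) \<in> D" for i j
    using that r(2)[OF that] 1 by (cases "j = N") auto
  moreover have "j < N" if "(i, j) \<in> T" for i j
    using that r(4)[OF that] 2 by (cases "j = N") auto
  ultimately show "X \<in> reduced N"
    unfolding X using DT by (blast intro: reduced_change_bound)
next
  fix X assume *: "X \<in> reduced N"
  obtain D T where X: "X = (D, T)" by fastforce
  note r = reducedD[OF *[unfolded X]]
  have "(D, T) \<in> reduced (Suc N)"
    using *[unfolded X] r(2,4) less_SucI by (blast intro: reduced_change_bound)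
  then show "X \<in> {X \<in> reduced (Suc N). (0, N) \<notin> fst X}"
    using r(2)[of 0 N] by (auto simp: X)
qed

text \<open>All arrows end before column \<open>N\<close>, so the added column is uncrossed and the
  status of the others does not change.\<close>

lemma card_uncrossed_Suc:
  assumes "X \<in> reduced N"
  shows "card (uncrossed (Suc N) (snd X)) = Suc (card (uncrossed N (snd X)))"
proof -
  have "d \<le> N" if "(c, d) \<in> snd X" for c d
    using that assms reducedD(4)[of "fst X" "snd X" N c d] by simp
  then have "uncrossed (Suc N) (snd X) = insert N (uncrossed N (snd X))"
    by (auto simp: uncrossed_def less_Suc_eq)
  then show ?thesis
    by (simp add: uncrossed_def)
qed

section \<open>Removing and restoring the first column\<close>

definition unshift :: "nat rel \<times> nat rel \<Rightarrow> nat rel \<times> nat rel" where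
  "unshift X = ({(i, j). (Suc i, Suc j) \<in> fst X}, {(i, j). (Suc i, Suc j) \<in> snd X})"

text \<open>The new first row of D is full, as restriction forces once it contains
  \<open>(0, N)\<close>. Restriction also makes the first row of T an initial segment, so the single
  number \<open>t\<close> describes it, with \<open>t = 0\<close> for the empty row.\<close>

definition shift :: "nat \<Rightarrow> nat \<Rightarrow> nat rel \<times> nat rel \<Rightarrow> nat rel \<times> nat rel" where
  "shift N t X =
     ({0} \<times> {..N} \<union> map_prod Suc Suc ` fst X, {0} \<times> {0<..t} \<union> map_prod Suc Suc ` snd X)"

text \<open>The admissible last elements t of the first row of a shifted system: every other value would
  violate transitivity with an arrow of T crossing t.\<close>

definition candidates :: "nat \<Rightarrow> nat rel \<times> nat rel \<Rightarrow> nat set" where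
  "candidates N X = insert 0 (Suc ` uncrossed N (snd X))"

lemma candidates: "finite (candidates N X)" "card (candidates N X) = Suc (card (uncrossed N (snd X)))"
  by (auto simp: candidates_def card_insert_if card_image)

lemma unshift_shift [simp]: "unshift (shift N t X) = X"
  by (auto simp: unshift_def shift_def prod_eq_iff)

text \<open>The choice of \<open>t\<close> matters only for transitivity from column 0: an arrow of
  T starting at or before \<open>t\<close> must also end there. The new arrows cross exactly the
  columns below \<open>t\<close>, so the candidates from \<open>t\<close> on are what remains
  uncrossed.\<close>

lemma shift_in_reduced:
  assumes "X \<in> reduced N" "t \<in> candidates N X"
  shows "shift N t X \<in> reduced (Suc N)" and "(0, N) \<in> fst (shift N t X)"
    and "uncrossed (Suc N) (snd (shift N t X)) = {c \<in> candidates N X. t \<le> c}"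
proof -
  obtain D T where X: "X = (D, T)" by fastforce
  note r = reducedD[OF assms(1)[unfolded X]]
  have t: "t \<le> N"
    using assms(2) by (auto simp: candidates_def uncrossed_def)
  have cross: "Suc d \<le> t" if "(c, d) \<in> T" "Suc c \<le> t" for c d
    using assms(2) that by (auto simp: candidates_def uncrossed_def X)
  define D' where "D' = {0} \<times> {..N} \<union> map_prod Suc Suc ` D"
  define T' where "T' = {0} \<times> {0<..t} \<union> map_prod Suc Suc ` T"
  have s: "shift N t X = (D', T')"
    by (simp add: shift_def D'_def T'_def X)
  have D'0: "(0, j) \<in> D' \<longleftrightarrow> j \<le> N" and D'S: "(Suc i, j) \<in> D' \<longleftrightarrow> (\<exists>k. j = Suc k \<and> (i, k) \<in> D)"
    for i j by (auto simp: D'_def)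
  have T'0: "(0, j) \<in> T' \<longleftrightarrow> 0 < j \<and> j \<le> t" and T'S: "(Suc i, j) \<in> T' \<longleftrightarrow> (\<exists>k. j = Suc k \<and> (i, k) \<in> T)"
    for i j by (auto simp: T'_def)
  have D'1: "i \<le> j \<and> j < Suc N" if "(i, j) \<in> D'" for i j
    using that r(1,2) by (auto simp: D'_def)
  have T'1: "i < j \<and> j < Suc N" if "(i, j) \<in> T'" for i j
    using that r(3,4) t by (auto simp: T'_def)
  have 3: "(k, j) \<in> D'" if "(i, j) \<in> D'" "k \<le> i" for i j k
    using that D'1[OF that(1)] r(5) by (cases i; cases k) (auto simp: D'0 D'S)
  have 4: "(i, k) \<in> D'" if "(i, j) \<in> D'" "i \<le> k" "k \<le> j" for i j k
    using that D'1[OF that(1)] r(6) by (cases i; cases k) (auto simp: D'0 D'S)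
  have 5: "(i, k) \<in> D'" if "(i, j) \<in> D'" "(j, k) \<in> T'" for i j k
    using that T'1[OF that(2)] r(7) by (cases i; cases j) (auto simp: D'0 D'S T'0 T'S)
  have 6: "(i, k) \<in> T'" if ij: "(i, j) \<in> T'" and jk: "(j, k) \<in> T'" for i j k
  proof -
    obtain j' where j: "j = Suc j'"
      using T'1[OF ij] by (cases j) auto
    then obtain k' where k: "k = Suc k'" "(j', k') \<in> T"
      using jk by (auto simp: T'S)
    show ?thesis
    proof (cases i)
      case 0
      then show ?thesis
        using ij cross[OF k(2)] by (simp add: T'0 j k(1))
    next
      case (Suc i')
      then show ?thesis
        using ij r(8)[OF _ k(2)] by (simp add: T'S j k(1))
    qed
  qed
  have 7: "(i, k) \<in> T'" if "(i, j) \<in> T'" "i < k" "k \<le> j" for i j k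
    using that by (cases i; cases k) (auto simp: T'0 T'S intro: r(9))
  have 8: "(i, i) \<in> D'" if "(i, j) \<in> T'" for i j
    using that r(10) by (cases i) (auto simp: D'0 D'S T'0 T'S)
  show "shift N t X \<in> reduced (Suc N)"
    unfolding s by (rule reducedI) (fact D'1 T'1 3 4 5 6 7 8)+
  show "(0, N) \<in> fst (shift N t X)"
    by (simp add: shift_def)
  have "b \<in> uncrossed (Suc N) T' \<longleftrightarrow> b \<in> candidates N X \<and> t \<le> b" for b
  proof -
    have "b \<in> uncrossed (Suc N) T' \<longleftrightarrow> b \<le> N \<and> t \<le> b \<and> (\<forall>c d. (c, d) \<in> T \<longrightarrow> Suc c \<le> b \<longrightarrow> Suc d \<le> b)"
    proof -
      \<comment> \<open>The arrows out of column 0 end at all of \<open>1, ..., t\<close>, so none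
        of them crosses \<open>b\<close> exactly when \<open>t \<le> b\<close>.\<close>
      have "t \<le> b \<longleftrightarrow> (\<forall>d. 0 < d \<and> d \<le> t \<longrightarrow> d \<le> b)"
        by (metis gr0I le0 le_trans order_refl)
      then show ?thesis
        unfolding uncrossed_def T'_def by (auto simp: less_Suc_eq_le)
    qed
    also have "\<dots> \<longleftrightarrow> b \<in> candidates N X \<and> t \<le> b"
      by (cases b) (auto simp: candidates_def uncrossed_def X)
    finally show ?thesis .
  qed
  then show "uncrossed (Suc N) (snd (shift N t X)) = {c \<in> candidates N X. t \<le> c}"
    by (auto simp: s)
qed

lemma unshift_in_reduced:
  assumes "X \<in> reduced (Suc N)" "(0, N) \<in> fst X"
  shows "unshift X \<in> reduced N" and "\<exists>t \<in> candidates N (unshift X). X = shift N t (unshift X)"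
proof -
  obtain D T where X: "X = (D, T)" by fastforce
  note r = reducedD[OF assms(1)[unfolded X]]
  show "unshift X \<in> reduced N"
    unfolding unshift_def X fst_conv snd_conv
  proof (rule reducedI, unfold mem_Collect_eq prod.case)
    fix i j k
    show "(Suc i, Suc j) \<in> D \<Longrightarrow> i \<le> j \<and> j < N"
      using r(1,2)[of "Suc i" "Suc j"] by simp
    show "(Suc i, Suc j) \<in> T \<Longrightarrow> i < j \<and> j < N"
      using r(3,4)[of "Suc i" "Suc j"] by simp
    show "(Suc i, Suc j) \<in> D \<Longrightarrow> k \<le> i \<Longrightarrow> (Suc k, Suc j) \<in> D"
      using r(5)[of "Suc i" "Suc j" "Suc k"] by simp
    show "(Suc i, Suc j) \<in> D \<Longrightarrow> i \<le> k \<Longrightarrow> k \<le> j \<Longrightarrow> (Suc i, Suc k) \<in> D"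
      using r(6)[of "Suc i" "Suc j" "Suc k"] by simp
    show "(Suc i, Suc j) \<in> D \<Longrightarrow> (Suc j, Suc k) \<in> T \<Longrightarrow> (Suc i, Suc k) \<in> D"
      by (rule r(7))
    show "(Suc i, Suc j) \<in> T \<Longrightarrow> (Suc j, Suc k) \<in> T \<Longrightarrow> (Suc i, Suc k) \<in> T"
      by (rule r(8))
    show "(Suc i, Suc j) \<in> T \<Longrightarrow> i < k \<Longrightarrow> k \<le> j \<Longrightarrow> (Suc i, Suc k) \<in> T"
      using r(9)[of "Suc i" "Suc j" "Suc k"] by simp
    show "(Suc i, Suc j) \<in> T \<Longrightarrow> (Suc i, Suc i) \<in> D"
      by (rule r(10))
  qed
  \<comment> \<open>Inserting 0 gives the maximum a value when no arrow of T leaves column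
    0.\<close>
  define t where "t = Max (insert 0 {j. (0, j) \<in> T})"
  have fin: "finite {j. (0, j) \<in> T}"
    by (rule finite_subset[of _ "{..<Suc N}"]) (use r(4) in auto)
  have t1: "j \<le> t" if "(0, j) \<in> T" for j
    unfolding t_def using fin that by (intro Max_ge) auto
  have t2: "t = 0 \<or> (0, t) \<in> T"
    using Max_in[of "insert 0 {j. (0, j) \<in> T}"] fin unfolding t_def by blast
  have row: "(0, j) \<in> T \<longleftrightarrow> 0 < j \<and> j \<le> t" for j
    using t1 t2 r(3) r(9)[of 0 t j] by (metis le_0_eq not_less)
  have T: "T = snd (shift N t (unshift X))"
  proof (intro set_eqI, clarify)
    fix i j show "(i, j) \<in> T \<longleftrightarrow> (i, j) \<in> snd (shift N t (unshift X))"
      using r(3)[of i j] row[of j] by (cases i; cases j) (auto simp: shift_def unshift_def X)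
  qed
  have D0: "(0, j) \<in> D \<longleftrightarrow> j \<le> N" for j
    using assms(2) r(6)[of 0 N j] r(2)[of 0 j] by (auto simp: X)
  have D: "D = fst (shift N t (unshift X))"
  proof (intro set_eqI, clarify)
    fix i j show "(i, j) \<in> D \<longleftrightarrow> (i, j) \<in> fst (shift N t (unshift X))"
      using r(1)[of i j] D0[of j] by (cases i; cases j) (auto simp: shift_def unshift_def X)
  qed
  have "t \<in> candidates N (unshift X)"
  proof (cases t)
    case (Suc u)
    have "u < N"
      using t2 r(4) Suc by auto
    \<comment> \<open>An arrow from column 0 to \<open>Suc c\<close> composes with
      \<open>(Suc c, Suc d)\<close>, so \<open>Suc d\<close> also lies in the first row of T and is
      at most \<open>t\<close>.\<close>
    moreover have "d \<le> u" if "(Suc c, Suc d) \<in> T" "c \<le> u" for c d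
      using row[of "Suc c"] row[of "Suc d"] r(8)[of 0 "Suc c" "Suc d"] that Suc by auto
    ultimately show ?thesis
      unfolding candidates_def uncrossed_def unshift_def X Suc by auto
  qed (simp add: candidates_def)
  moreover have "X = shift N t (unshift X)"
    using D T X by (metis prod.collapse)
  ultimately show "\<exists>t \<in> candidates N (unshift X). X = shift N t (unshift X)" ..
qed

lemma card_filter_split:
  assumes "finite A"
  shows "card A = card {x \<in> A. \<not> P x} + card {x \<in> A. P x}"
proof -
  have "A = {x \<in> A. \<not> P x} \<union> {x \<in> A. P x}"
    by blast
  also have "card \<dots> = card {x \<in> A. \<not> P x} + card {x \<in> A. P x}"
    using assms by (intro card_Un_disjoint) auto
  finally show ?thesis .
qed

text \<open>The number of elements of C from \<open>t\<close> on strictly decreases as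
  \<open>t\<close> grows within C.\<close>

lemma card_ge_inj:
  fixes C :: "'a::linorder set"
  assumes "finite C" "t \<in> C" "u \<in> C" "card {c \<in> C. t \<le> c} = card {c \<in> C. u \<le> c}"
  shows "t = u"
proof -
  have "\<not> t < u" if "t \<in> C" "card {c \<in> C. t \<le> c} = card {c \<in> C. u \<le> c}" for t u
  proof
    assume "t < u"
    then have "{c \<in> C. u \<le> c} \<subset> {c \<in> C. t \<le> c}"
      using that by force
    then show False
      using psubset_card_mono[of "{c \<in> C. t \<le> c}" "{c \<in> C. u \<le> c}"] that assms(1) by simp
  qed
  then show ?thesis
    using assms by (metis linorder_neqE)
qed

text \<open>The counting map is injective from C into \<open>{0<..card C}\<close>, a set of the same
  size.\<close>

lemma card_ge_surj:
  fixes C :: "'a::linorder set"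
  assumes "finite C" "0 < s" "s \<le> card C"
  shows "\<exists>t \<in> C. card {c \<in> C. t \<le> c} = s"
proof -
  let ?f = "\<lambda>t. card {c \<in> C. t \<le> c}"
  have inj: "inj_on ?f C"
    using card_ge_inj[OF assms(1)] by (auto intro: inj_onI)
  have "?f ` C \<subseteq> {0<..card C}"
    using assms(1) by (auto simp: card_gt_0_iff intro: card_mono)
  then have "?f ` C = {0<..card C}"
    by (intro card_subset_eq) (auto simp: card_image[OF inj])
  then show ?thesis
    using assms by (metis (mono_tags, lifting) greaterThanAtMost_iff imageE)
qed

text \<open>A remainder with \<open>j\<close> uncrossed columns has \<open>j + 1\<close> candidates.
  Exactly one of them has \<open>Suc s\<close> candidates from itself on if
  \<open>s \<le> j\<close>, and none otherwise; this rank is the number of uncrossed columns after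
  restoring the first column.\<close>

lemma bij_betw_unshift:
  "bij_betw unshift {X \<in> reduced (Suc N). (0, N) \<in> fst X \<and> card (uncrossed (Suc N) (snd X)) = Suc s}
     {X \<in> reduced N. s \<le> card (uncrossed N (snd X))}"
    (is "bij_betw _ ?A ?B")
proof (rule bij_betwI')
  have up: "\<exists>t \<in> candidates N (unshift X). X = shift N t (unshift X) \<and>
      card {c \<in> candidates N (unshift X). t \<le> c} = Suc s" if "X \<in> ?A" for X
  proof -
    have X: "X \<in> reduced (Suc N)" "(0, N) \<in> fst X"
      using that by auto
    obtain t where t: "t \<in> candidates N (unshift X)" and eq: "X = shift N t (unshift X)"
      using unshift_in_reduced(2)[OF X] by blast
    have "uncrossed (Suc N) (snd X) = {c \<in> candidates N (unshift X). t \<le> c}"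
      using shift_in_reduced(3)[OF unshift_in_reduced(1)[OF X] t] eq[symmetric] by simp
    then show ?thesis
      using t eq that by (intro bexI[OF _ t]) simp
  qed
  show "unshift X = unshift Y \<longleftrightarrow> X = Y" if "X \<in> ?A" "Y \<in> ?A" for X Y
    using up[OF that(1)] up[OF that(2)] card_ge_inj[OF candidates(1)] by metis
  show "unshift X \<in> ?B" if X: "X \<in> ?A" for X
  proof -
    obtain t where "card {c \<in> candidates N (unshift X). t \<le> c} = Suc s"
      using up[OF X] by blast
    moreover have "card {c \<in> candidates N (unshift X). t \<le> c} \<le> card (candidates N (unshift X))"
      by (intro card_mono candidates) auto
    ultimately show ?thesis
      using X unshift_in_reduced(1)[of X N] candidates(2)[of N "unshift X"] by auto
  qed
  show "\<exists>Y \<in> ?A. X = unshift Y" if X: "X \<in> ?B" for X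
  proof -
    obtain t where "t \<in> candidates N X" "card {c \<in> candidates N X. t \<le> c} = Suc s"
      using card_ge_surj[of "candidates N X" "Suc s"] X candidates[of N X] by auto
    then show ?thesis
      using shift_in_reduced[of X N t] X by (intro bexI[of _ "shift N t X"]) auto
  qed
qed

lemma card_reduced_Suc:
  "card {X \<in> reduced (Suc N). card (uncrossed (Suc N) (snd X)) = Suc s} =
     card {X \<in> reduced N. card (uncrossed N (snd X)) = s} +
     card {X \<in> reduced N. s \<le> card (uncrossed N (snd X))}"
proof -
  let ?A = "{X \<in> reduced (Suc N). card (uncrossed (Suc N) (snd X)) = Suc s}"
  have "finite ?A"
    by (rule finite_subset[OF _ finite_reduced[of "Suc N"]]) blast
  then have "card ?A = card {X \<in> ?A. (0, N) \<notin> fst X} + card {X \<in> ?A. (0, N) \<in> fst X}"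
    by (rule card_filter_split)
  also have "{X \<in> ?A. (0, N) \<notin> fst X} =
      {X \<in> {X \<in> reduced (Suc N). (0, N) \<notin> fst X}. card (uncrossed (Suc N) (snd X)) = Suc s}"
    by blast
  also have "\<dots> = {X \<in> reduced N. card (uncrossed (Suc N) (snd X)) = Suc s}"
    by (simp only: reduced_Suc_not_top)
  also have "\<dots> = {X \<in> reduced N. card (uncrossed N (snd X)) = s}"
    by (intro Collect_cong conj_cong refl) (simp only: card_uncrossed_Suc nat.inject)
  also have "{X \<in> ?A. (0, N) \<in> fst X} =
      {X \<in> reduced (Suc N). (0, N) \<in> fst X \<and> card (uncrossed (Suc N) (snd X)) = Suc s}"
    by blast
  also have "card \<dots> = card {X \<in> reduced N. s \<le> card (uncrossed N (snd X))}"
    by (rule bij_betw_same_card[OF bij_betw_unshift])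
  finally show ?thesis .
qed

text \<open>No arrow passes beyond the last column. This settles the value 0, which the recursion
  leaves out.\<close>

lemma card_uncrossed_reduced_Suc:
  assumes "X \<in> reduced (Suc N)"
  shows "card (uncrossed (Suc N) (snd X)) \<noteq> 0"
proof -
  have "d \<le> N" if "(c, d) \<in> snd X" for c d
    using that assms reducedD(4)[of "fst X" "snd X" "Suc N" c d] by simp
  then have "N \<in> uncrossed (Suc N) (snd X)"
    by (auto simp: uncrossed_def)
  then show ?thesis
    by (metis card_0_eq empty_iff finite_uncrossed)
qed

section \<open>A recursion for royal paths\<close>

text \<open>Here h is the excess x - y of the starting point, so that the diagonal is h = 0. In
  \<open>returns_from\<close> truncated subtraction is harmless only on words accepted by \<open>royal_from\<close>.\<close>

fun royal_from :: "nat \<Rightarrow> (nat \<times> nat) list \<Rightarrow> bool" where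
  "royal_from h [] \<longleftrightarrow> h = 0"
| "royal_from h (s # w) \<longleftrightarrow> s \<in> {(0, 1), (1, 1), (1, 0)} \<and> snd s \<le> h + fst s \<and>
     royal_from (h + fst s - snd s) w"

fun returns_from :: "nat \<Rightarrow> (nat \<times> nat) list \<Rightarrow> nat" where
  "returns_from h [] = 0"
| "returns_from h (s # w) = (if h + fst s - snd s = 0 then 1 else 0) + returns_from (h + fst s - snd s) w"

abbreviation width :: "(nat \<times> nat) list \<Rightarrow> nat" where
  "width w \<equiv> sum_list (map fst w)"

lemma path_point_Nil [simp]: "path_point [] i = 0"
  and path_point_0 [simp]: "path_point w 0 = 0"
  and path_point_Suc [simp]: "path_point (s # w) (Suc i) = s + path_point w i"
  by (simp_all add: path_point_def)

lemma all_le_Suc_split: "(\<forall>i \<le> Suc n. P i) \<longleftrightarrow> P 0 \<and> (\<forall>i \<le> n. P (Suc i))"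
  by (metis Suc_le_mono le0 not0_implies_Suc)

text \<open>The start \<open>(x, y)\<close> is arbitrary so that the induction can move it past the
  first step.\<close>

lemma royal_from_iff:
  assumes "y \<le> x"
  shows "royal_from (x - y) w \<longleftrightarrow> set w \<subseteq> {(0, 1), (1, 1), (1, 0)} \<and>
     fst (path_point w (length w)) + x = snd (path_point w (length w)) + y \<and>
     (\<forall>i \<le> length w. snd (path_point w i) + y \<le> fst (path_point w i) + x)"
  using assms
proof (induction w arbitrary: x y)
  case Nil
  then show ?case by auto
next
  case (Cons s w)
  obtain a b where s: "s = (a, b)" by fastforce
  have "royal_from (x - y) (s # w) \<longleftrightarrow> s \<in> {(0, 1), (1, 1), (1, 0)} \<and> y + b \<le> x + a \<and>
      royal_from ((x + a) - (y + b)) w"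
    using Cons.prems by (auto simp: s)
  also have "\<dots> \<longleftrightarrow> s \<in> {(0, 1), (1, 1), (1, 0)} \<and> y + b \<le> x + a \<and> set w \<subseteq> {(0, 1), (1, 1), (1, 0)} \<and>
     fst (path_point w (length w)) + (x + a) = snd (path_point w (length w)) + (y + b) \<and>
     (\<forall>i \<le> length w. snd (path_point w i) + (y + b) \<le> fst (path_point w i) + (x + a))"
    using Cons.IH[of "y + b" "x + a"] by blast
  also have "\<dots> \<longleftrightarrow> set (s # w) \<subseteq> {(0, 1), (1, 1), (1, 0)} \<and>
     fst (path_point (s # w) (length (s # w))) + x = snd (path_point (s # w) (length (s # w))) + y \<and>
     (\<forall>i \<le> length (s # w). snd (path_point (s # w) i) + y \<le> fst (path_point (s # w) i) + x)"
    unfolding length_Cons all_le_Suc_split path_point_Suc path_point_0 s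
    \<comment> \<open>Index 0 of the remaining path is the end of the first step; it yields
      \<open>y + b \<le> x + a\<close>.\<close>
    using Cons.prems spec[of _ 0]
    by (auto simp: add_ac)
  finally show ?case .
qed

lemma fst_path_point_length: "fst (path_point w (length w)) = width w"
  by (induction w) auto

lemma royal_paths_iff: "w \<in> royal_paths n \<longleftrightarrow> royal_from 0 w \<and> width w = n"
  using royal_from_iff[of 0 0 w] fst_path_point_length[of w]
  by (auto simp: royal_paths_def prod_eq_iff)

lemma card_return_indices:
  assumes "y \<le> x" "royal_from (x - y) w"
  shows "card {i. 0 < i \<and> i \<le> length w \<and> fst (path_point w i) + x = snd (path_point w i) + y} =
     returns_from (x - y) w"
  using assms
proof (induction w arbitrary: x y)
  case Nil
  then show ?case by auto
next
  case (Cons s w)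
  obtain a b where s: "s = (a, b)" by fastforce
  let ?I = "\<lambda>x y w. {i. 0 < i \<and> i \<le> length w \<and> fst (path_point w i) + x = snd (path_point w i) + y}"
  have le: "y + b \<le> x + a" and w: "royal_from ((x + a) - (y + b)) w"
    using Cons.prems by (auto simp: s)
  have "i \<in> ?I x y (s # w) \<longleftrightarrow> i \<in> (if x + a = y + b then {1} else {}) \<union> Suc ` ?I (x + a) (y + b) w" for i
    by (cases i; cases "i = 1") (auto simp: s add_ac image_iff)
  then have "?I x y (s # w) = (if x + a = y + b then {1} else {}) \<union> Suc ` ?I (x + a) (y + b) w"
    by blast
  then have "card (?I x y (s # w)) = (if x + a = y + b then 1 else 0) + card (?I (x + a) (y + b) w)"
    by (auto simp: card_insert_if card_image)
  also have "card (?I (x + a) (y + b) w) = returns_from ((x + a) - (y + b)) w"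
    using Cons.IH[OF le w] .
  finally show ?case
    using le Cons.prems(1) by (auto simp: s)
qed

lemma strict_mono_path_point:
  assumes "(0, 0) \<notin> set w" "i < j" "j \<le> length w"
  shows "fst (path_point w i) + snd (path_point w i) < fst (path_point w j) + snd (path_point w j)"
  using assms
proof (induction w arbitrary: i j)
  case (Cons s w)
  have "0 < fst s + snd s"
    using Cons.prems(1) by (cases s) auto
  with Cons show ?case
    by (cases j; cases i) (auto simp: add_ac)
qed simp

text \<open>\<open>path_returns\<close> is a set of points whereas \<open>returns_from\<close>
  counts indices. The sum of the coordinates grows with every step, so no point is visited twice and
  the counts agree.\<close>

lemma card_path_returns:
  assumes "royal_from 0 w"
  shows "card (path_returns w) = returns_from 0 w"
proof -
  have "set w \<subseteq> {(0, 1), (1, 1), (1, 0)}"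
    using assms royal_from_iff[of 0 0 w] by simp
  then have w: "(0, 0) \<notin> set w" by auto
  have "path_returns w = path_point w ` {i. 0 < i \<and> i \<le> length w \<and> fst (path_point w i) = snd (path_point w i)}"
    by (auto simp: path_returns_def)
  moreover have "inj_on (path_point w) {..length w}"
    by (intro linorder_inj_onI) (use strict_mono_path_point[OF w] in fastforce)+
  then have "inj_on (path_point w) {i. 0 < i \<and> i \<le> length w \<and> fst (path_point w i) = snd (path_point w i)}"
    by (rule inj_on_subset) auto
  ultimately show ?thesis
    using card_return_indices[of 0 0 w] assms by (simp add: card_image)
qed

lemma finite_royal_paths: "finite (royal_paths n)"
proof (rule finite_subset)
  \<comment> \<open>There are \<open>h\<close> more north steps than east steps, and every other
    step adds 1 to the width.\<close>
  have "length w \<le> h + 2 * width w" if "royal_from h w" for h w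
    using that by (induction w arbitrary: h) fastforce+
  then show "royal_paths n \<subseteq> {w. set w \<subseteq> {(0, 1), (1, 1), (1, 0)} \<and> length w \<le> 2 * n}"
    using royal_paths_iff[of _ n] by (fastforce simp: royal_paths_def)
  show "finite {w. set w \<subseteq> {(0, 1), (1, 1), (1, 0 :: nat)} \<and> length w \<le> 2 * n}"
    by (intro finite_lists_length_le) simp
qed

text \<open>The input path starts at excess \<open>Suc h\<close>, the output at \<open>h\<close>.
  The deleted step is the first one reaching the diagonal; on royal words it is a north step taken
  at \<open>h = 0\<close>.\<close>

fun delete_descent :: "nat \<Rightarrow> (nat \<times> nat) list \<Rightarrow> (nat \<times> nat) list" where
  "delete_descent h [] = []"
| "delete_descent h (s # w) =
     (if Suc h + fst s - snd s = 0 then w else s # delete_descent (h + fst s - snd s) w)"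

text \<open>The insertion point is unique because exactly one visit to the diagonal is followed by
  k returns.\<close>

fun insert_descent :: "nat \<Rightarrow> nat \<Rightarrow> (nat \<times> nat) list \<Rightarrow> (nat \<times> nat) list" where
  "insert_descent k h w = (if h = 0 \<and> returns_from h w = k then (0, 1) # w
     else case w of [] \<Rightarrow> [] | s # v \<Rightarrow> s # insert_descent k (h + fst s - snd s) v)"

declare insert_descent.simps [simp del]

text \<open>The path first returns at the deleted step, so \<open>returns_from (Suc h) w - 1\<close>
  returns follow it, and these survive. If \<open>h > 0\<close>, the point of deletion becomes a
  further return of the shortened path; if \<open>h = 0\<close>, it may be the uncounted start,
  which explains the correction term.\<close>

lemma delete_descent:
  assumes "royal_from (Suc h) w"
  shows "royal_from h (delete_descent h w)" and "width (delete_descent h w) = width w"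
    and "returns_from (Suc h) w \<le> returns_from h (delete_descent h w) + (if h = 0 then 1 else 0)"
    and "0 < returns_from (Suc h) w"
    and "insert_descent (returns_from (Suc h) w - 1) h (delete_descent h w) = w"
proof -
  have "royal_from h (delete_descent h w) \<and> width (delete_descent h w) = width w \<and>
    returns_from (Suc h) w \<le> returns_from h (delete_descent h w) + (if h = 0 then 1 else 0) \<and>
    0 < returns_from (Suc h) w \<and>
    insert_descent (returns_from (Suc h) w - 1) h (delete_descent h w) = w"
    using assms
  proof (induction w arbitrary: h)
    case (Cons s w)
    show ?case
    proof (cases "Suc h + fst s - snd s = 0")
      case True
      then have "h = 0" "s = (0, 1)"
        using Cons.prems by auto
      then show ?thesis
        using Cons.prems by (simp add: insert_descent.simps)
    next
      case False
      define h' where "h' = h + fst s - snd s"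
      have h': "Suc h + fst s - snd s = Suc h'" and le: "snd s \<le> h + fst s"
        using False by (auto simp: h'_def)
      have s: "s \<in> {(0, 1), (1, 1), (1, 0)}" and w: "royal_from (Suc h') w"
        using Cons.prems h' by auto
      \<comment> \<open>At an earlier visit to the diagonal the point of deletion is itself still
        ahead as a return, so more returns follow than the number sought.\<close>
      have *: "\<not> (h = 0 \<and> returns_from h (s # delete_descent h' w) = returns_from (Suc h') w - 1)"
        using Cons.IH[OF w] by (auto simp: h'_def[symmetric] split: if_splits)
      then have "insert_descent (returns_from (Suc h') w - 1) h (s # delete_descent h' w) = s # w"
        using Cons.IH[OF w] by (subst insert_descent.simps) (auto simp: h'_def[symmetric])
      then show ?thesis
        using Cons.IH[OF w] s le False h' by (auto simp: h'_def[symmetric])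
    qed
  qed simp
  then show "royal_from h (delete_descent h w)" "width (delete_descent h w) = width w"
    "returns_from (Suc h) w \<le> returns_from h (delete_descent h w) + (if h = 0 then 1 else 0)"
    "0 < returns_from (Suc h) w"
    "insert_descent (returns_from (Suc h) w - 1) h (delete_descent h w) = w"
    by auto
qed

text \<open>Starting on the diagonal, the start itself can be the insertion point, so
  \<open>k\<close> returns suffice. Otherwise the insertion point is itself a return and one more is
  required.\<close>

lemma insert_descent:
  assumes "royal_from h w" "k + (if h = 0 then 0 else 1) \<le> returns_from h w"
  shows "royal_from (Suc h) (insert_descent k h w)" and "width (insert_descent k h w) = width w"
    and "returns_from (Suc h) (insert_descent k h w) = Suc k"
    and "delete_descent h (insert_descent k h w) = w"
proof -
  have "royal_from (Suc h) (insert_descent k h w) \<and> width (insert_descent k h w) = width w \<and>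
    returns_from (Suc h) (insert_descent k h w) = Suc k \<and>
    delete_descent h (insert_descent k h w) = w"
    using assms
  proof (induction w arbitrary: h)
    case Nil
    then show ?case by (simp add: insert_descent.simps)
  next
    case (Cons s w)
    show ?case
    proof (cases "h = 0 \<and> returns_from h (s # w) = k")
      case True
      then have "insert_descent k h (s # w) = (0, 1) # s # w"
        by (subst insert_descent.simps) (rule if_P[OF True])
      then show ?thesis
        using Cons.prems conjunct1[OF True] conjunct2[OF True] by (cases "h = 0") simp_all
    next
      case False
      define h' where "h' = h + fst s - snd s"
      have s: "s \<in> {(0, 1), (1, 1), (1, 0)}" and le: "snd s \<le> h + fst s" and w: "royal_from h' w"
        using Cons.prems by (auto simp: h'_def)
      have h': "Suc h + fst s - snd s = Suc h'"
        using le by (auto simp: h'_def)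
      \<comment> \<open>Since no insertion takes place here, at least \<open>k + 1\<close> returns
        lie ahead even if \<open>h = 0\<close>. A step onto the diagonal uses up one of them, but
        then \<open>k\<close> are enough.\<close>
      have "k + (if h' = 0 then 0 else 1) \<le> returns_from h' w"
        using Cons.prems(2) False by (auto simp: h'_def[symmetric] split: if_splits)
      note IH = Cons.IH[OF w this]
      have "insert_descent k h (s # w) = s # insert_descent k h' w"
        using False by (subst insert_descent.simps) (auto simp: h'_def)
      then show ?thesis
        using IH s le h' by (auto simp: h'_def[symmetric])
    qed
  qed
  then show "royal_from (Suc h) (insert_descent k h w)" "width (insert_descent k h w) = width w"
    "returns_from (Suc h) (insert_descent k h w) = Suc k"
    "delete_descent h (insert_descent k h w) = w"
    by auto
qed

section \<open>Splitting royal paths by their first step\<close>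

lemma royal_path_Suc_cases:
  assumes "w \<in> royal_paths (Suc n)"
  obtains v where "w = (1, 1) # v" "v \<in> royal_paths n"
  | v where "w = (1, 0) # v" "royal_from 1 v" "width v = n"
  using assms by (cases w) (auto simp: royal_paths_iff)

text \<open>The initial east step makes no return, so of the \<open>Suc k\<close> returns exactly
  \<open>k\<close> come after the deleted north step. They remain in the shortened path, and
  conversely any path with at least \<open>k\<close> returns has a unique place for
  reinsertion.\<close>

lemma bij_betw_delete_descent:
  "bij_betw (\<lambda>w. delete_descent 0 (tl w))
     {w \<in> royal_paths (Suc n). hd w = (1, 0) \<and> returns_from 0 w = Suc k}
     {w \<in> royal_paths n. k \<le> returns_from 0 w}" (is "bij_betw _ ?A ?B")
proof (rule bij_betw_byWitness[where f' = "\<lambda>w. (1, 0) # insert_descent k 0 w"])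
  have A: "\<exists>v. w = (1, 0) # v \<and> royal_from (Suc 0) v \<and> width v = n \<and> returns_from (Suc 0) v = Suc k"
    if "w \<in> ?A" for w
    using that by (auto elim!: royal_path_Suc_cases)
  show "\<forall>w \<in> ?A. (1, 0) # insert_descent k 0 (delete_descent 0 (tl w)) = w"
    using A delete_descent(5)[of 0] by fastforce
  show "\<forall>w \<in> ?B. delete_descent 0 (tl ((1, 0) # insert_descent k 0 w)) = w"
    using insert_descent(4)[of 0] by (auto simp: royal_paths_iff)
  show "(\<lambda>w. delete_descent 0 (tl w)) ` ?A \<subseteq> ?B"
    using A delete_descent(1-3)[of 0] by (fastforce simp: royal_paths_iff)
  show "(\<lambda>w. (1, 0) # insert_descent k 0 w) ` ?B \<subseteq> ?A"
    using insert_descent(1-3)[of 0] by (auto simp: royal_paths_iff)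
qed

lemma card_royal_paths_Suc:
  "card {w \<in> royal_paths (Suc n). returns_from 0 w = Suc k} =
     card {w \<in> royal_paths n. returns_from 0 w = k} +
     card {w \<in> royal_paths n. k \<le> returns_from 0 w}"
proof -
  let ?A = "{w \<in> royal_paths (Suc n). returns_from 0 w = Suc k}"
  have "finite ?A"
    by (rule finite_subset[OF _ finite_royal_paths[of "Suc n"]]) blast
  then have "card ?A = card {w \<in> ?A. hd w \<noteq> (1, 0)} + card {w \<in> ?A. hd w = (1, 0)}"
    by (rule card_filter_split)
  also have "{w \<in> ?A. hd w \<noteq> (1, 0)} = Cons (1, 1) ` {w \<in> royal_paths n. returns_from 0 w = k}"
    by (auto simp: image_iff elim!: royal_path_Suc_cases) (auto simp: royal_paths_iff)
  also have "card \<dots> = card {w \<in> royal_paths n. returns_from 0 w = k}"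
    by (rule card_image) simp
  also have "{w \<in> ?A. hd w = (1, 0)} =
      {w \<in> royal_paths (Suc n). hd w = (1, 0) \<and> returns_from 0 w = Suc k}"
    by blast
  also have "card \<dots> = card {w \<in> royal_paths n. k \<le> returns_from 0 w}"
    by (rule bij_betw_same_card[OF bij_betw_delete_descent])
  finally show ?thesis .
qed

lemma returns_from_royal_Suc:
  assumes "w \<in> royal_paths (Suc n)"
  shows "returns_from 0 w \<noteq> 0"
  using assms
proof (cases rule: royal_path_Suc_cases)
  case (2 v)
  then show ?thesis
    using delete_descent(4)[of 0 v] by simp
qed simp

lemma royal_paths_0: "royal_paths 0 = {[]}"
proof -
  have "w = []" if "royal_from 0 w" "width w = 0" for w
    using that by (cases w) auto
  then show ?thesis
    by (auto simp: royal_paths_iff)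
qed

section \<open>Comparison of the two recursions\<close>

lemma card_filter_eq_sum:
  assumes "finite A" "finite J" "f ` A \<subseteq> J"
  shows "card {x \<in> A. P (f x)} = (\<Sum>j\<in>{j \<in> J. P j}. card {x \<in> A. f x = j})"
proof -
  have "{x \<in> A. P (f x)} = (\<Union>j\<in>{j \<in> J. P j}. {x \<in> A. f x = j})"
    using assms(3) by auto
  also have "card \<dots> = (\<Sum>j\<in>{j \<in> J. P j}. card {x \<in> A. f x = j})"
    using assms(1,2) by (intro card_UN_disjoint) auto
  finally show ?thesis .
qed

text \<open>Equidistribution of two statistics is passed on to every predicate of their values, in
  particular to the tail counts \<open>k \<le> j\<close> in both recursions.\<close>

lemma card_filter_cong_fibres:
  assumes "finite A" "finite B" "\<And>j. card {x \<in> A. f x = j} = card {y \<in> B. g y = j}"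
  shows "card {x \<in> A. P (f x)} = card {y \<in> B. P (g y)}"
  using card_filter_eq_sum[of A "f ` A \<union> g ` B" f P] card_filter_eq_sum[of B "f ` A \<union> g ` B" g P] assms
  by simp

lemma card_reduced_eq_card_royal_paths:
  "card {X \<in> reduced N. card (uncrossed N (snd X)) = s} = card {w \<in> royal_paths N. returns_from 0 w = s}"
proof (induction N arbitrary: s)
  case 0
  have "{X \<in> reduced 0. card (uncrossed 0 (snd X)) = s} = (if s = 0 then {({}, {})} else {})"
    by (auto simp: reduced_0 uncrossed_def)
  moreover have "{w \<in> royal_paths 0. returns_from 0 w = s} = (if s = 0 then {[]} else {})"
    by (auto simp: royal_paths_0)
  ultimately show ?case by simp
next
  case (Suc N)
  show ?case
  proof (cases s)
    \<comment> \<open>The recursions only reach values of the form \<open>Suc k\<close>; at 0 both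
      sets are empty.\<close>
    case 0
    then have "{X \<in> reduced (Suc N). card (uncrossed (Suc N) (snd X)) = s} = {}"
      "{w \<in> royal_paths (Suc N). returns_from 0 w = s} = {}"
      using card_uncrossed_reduced_Suc returns_from_royal_Suc by blast+
    then show ?thesis by (simp only: card.empty)
  next
    case (Suc k)
    have "card {X \<in> reduced N. k \<le> card (uncrossed N (snd X))} =
        card {w \<in> royal_paths N. k \<le> returns_from 0 w}"
      using finite_reduced finite_royal_paths Suc.IH
      by (rule card_filter_cong_fibres[where P = "\<lambda>j. k \<le> j"])
    then show ?thesis
      by (simp only: Suc card_reduced_Suc card_royal_paths_Suc Suc.IH)
  qed
qed

theorem theorem6p9:
  fixes n :: nat
  shows "card {R \<in> liftable_transfer_systems n. maximally_extendable n R} = schroeder (n + 1) \<and>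
    (\<forall>k. 1 \<le> k \<and> k \<le> n + 1 \<longrightarrow>
       card {R \<in> liftable_transfer_systems n. maximally_extendable n R \<and>
               card (stationary_elements n R) = k} = refined_schroeder (n + 1) k)"
proof -
  let ?A = "{R \<in> liftable_transfer_systems n. maximally_extendable n R}"
  \<comment> \<open>With an arbitrary predicate \<open>P\<close>, both claims become instances:
    \<open>P\<close> constantly true gives the total, equality with \<open>k\<close> the
    refinement.\<close>
  have "card {R \<in> ?A. P (card (stationary_elements n R))} =
      card {w \<in> royal_paths (Suc n). P (card (path_returns w))}" for P
  proof -
    have "card (uncrossed (Suc n) (snd (reduce R))) = card (stationary_elements n R)" if "R \<in> ?A" for R
      using that by (simp add: liftable_transfer_systems_def card_stationary)
    then have "bij_betw reduce {R \<in> ?A. P (card (stationary_elements n R))}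
        {X \<in> reduced (Suc n). P (card (uncrossed (Suc n) (snd X)))}"
      by (intro bij_betw_Collect[OF bij_betw_reduce]) (simp only:)
    then have "card {R \<in> ?A. P (card (stationary_elements n R))} =
        card {X \<in> reduced (Suc n). P (card (uncrossed (Suc n) (snd X)))}"
      by (rule bij_betw_same_card)
    also have "\<dots> = card {w \<in> royal_paths (Suc n). P (returns_from 0 w)}"
      using finite_reduced finite_royal_paths card_reduced_eq_card_royal_paths
      by (rule card_filter_cong_fibres[where P = P])
    also have "{w \<in> royal_paths (Suc n). P (returns_from 0 w)} =
        {w \<in> royal_paths (Suc n). P (card (path_returns w))}"
      by (intro Collect_cong conj_cong refl) (simp only: royal_paths_iff card_path_returns)
    finally show ?thesis .
  qed
  from this[of "\<lambda>_. True"] this[of "\<lambda>j. j = k" for k] show ?thesis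
    by (simp add: schroeder_def refined_schroeder_def conj_assoc)
qed

end
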